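(* (Submanifolds of arbitrary dimension.) Let $n\ge2$, $m\ge1$, let $D\subset\mathbb R^n$ be a simply connected open set with coordinates $u^1,\dots,u^n$, $\partial_i=\partial/\partial u^i$, and let $\beta_{ij}$ ($i\ne j$) be smooth functions on $D$ satisfying $$\partial_k\beta_{ij}=\beta_{ik}\beta_{kj}\ \ (i,j,k \text{ distinct}),\qquad \partial_i\beta_{ij}+\partial_j\beta_{ji}+\sum_{k\ne i,j}\beta_{ki}\beta_{kj}=0\ \ (i\neq j).$$ Let ${\bf X}_i=(X_{1i},\dots,X_{ni})$, $i=1,\dots,n$, be pairwise orthogonal unit vector functions on $D$ satisfying $$\partial_j{\bf X}_i=\beta_{ij}{\bf X}_j\ (j\ne i),\qquad \partial_i{\bf X}_i=-\sum_{k\neq i}\beta_{ki}{\bf X}_k .$$ Let $(H^\alpha_1,\dots,H^\alpha_n)$, $\alpha=1,\dots,m$, be $m$ arbitrary smooth solutions of the linear system $\partial_iH_j=\beta_{ij}H_i$ ($i\neq j$), and let $s^\alpha_i$ be functions with $$ds^\alpha_i=\sum_{k=1}^nX_{ik}H^\alpha_k\,du^k .$$ Let $U$ be the $n\times m$ matrix with entries $U_{i\alpha}=s^\alpha_i$, let $V$ be an $m\times m$ matrix function satisfying $$dV=U^t\,dU,\qquad V+V^t=U^tU+E_m,$$ assumed invertible, and let $W$ be the $(m+n)\times m$ matrix $$W=\begin{pmatrix}UV^{-1}\\ V^{-1}-E_m\end{pmatrix}$$ with columns ${\bf w}^1,\dots,{\bf w}^m$. Then $W^tW=E_m$. Moreover,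 for each $\gamma\in\{1,\dots,m\}$ for which ${\bf w}^\gamma$ is an immersion, ${\bf w}^\gamma$ is the radius-vector of a submanifold $M^n\subset S^{m+n-1}\subset E^{m+n}$ with flat normal bundle, the remaining columns ${\bf w}^\alpha$, $\alpha\neq\gamma$, are orthogonal to $M^n$ and parallel in the normal bundle, and $u^1,\dots,u^n$ are coordinates of the lines of curvature of $M^n$.
   Context: $E^{N}$ is Euclidean $N$-space, $S^{m+n-1}$ is the unit hypersphere in $E^{m+n}$, $E_m$ is the $m\times m$ identity matrix, $t$ is transposition. All functions are smooth. A submanifold $M^n\subset S^{m+n-1}$ with radius-vector ${\bf r}$ has flat normal bundle if (locally) there exist $m-1$ pairwise orthogonal unit vector fields ${\bf n}^\alpha$ along $M^n$, orthogonal to ${\bf r}$ and $TM^n$, with $d{\bf n}^\alpha\in TM^n$ for all $\alpha$; such normals are called parallel in the normal bundle. Coordinates $u^i$ are coordinates of the lines of curvature if the metric $(d{\bf r},d{\bf r})$ and all the forms $(d{\bf r},d{\bf n}^\alpha)$ are diagonal in them; equivalently, the vectors $\partial_i{\bf r}$ are pairwise orthogonal and $\partial_i{\bf n}^\alpha$ is proportional to $\partial_i{\bf r}$ for all $i,\alpha$. *)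

theory Defs
  imports "HOL-Analysis.Analysis"
begin

fun Ck_on :: "nat \<Rightarrow> 'a::real_normed_vector set \<Rightarrow> ('a \<Rightarrow> 'b::real_normed_vector) \<Rightarrow> bool" where
  "Ck_on 0 S f \<longleftrightarrow> continuous_on S f"
| "Ck_on (Suc k) S f \<longleftrightarrow>
     (\<forall>x\<in>S. f differentiable (at x)) \<and>
     (\<forall>v. Ck_on k S (\<lambda>x. frechet_derivative f (at x) v))"

text \<open>Used for open \<open>S\<close> only.\<close>

definition smooth_on :: "'a::real_normed_vector set \<Rightarrow> ('a \<Rightarrow> 'b::real_normed_vector) \<Rightarrow> bool" where
  "smooth_on S f \<longleftrightarrow> (\<forall>k. Ck_on k S f)"

definition pdiff :: "'n::finite \<Rightarrow> (real^'n \<Rightarrow> 'b::real_normed_vector) \<Rightarrow> real^'n \<Rightarrow> 'b" where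
  "pdiff i f u = frechet_derivative f (at u) (axis i 1)"

definition stack_rows :: "'c^'m^'n \<Rightarrow> 'c^'m^'k \<Rightarrow> 'c^'m^('n::finite + 'k::finite)" where
  "stack_rows A B = (\<chi> i. case i of Inl p \<Rightarrow> A $ p | Inr q \<Rightarrow> B $ q)"

text \<open>
  A submanifold is given by its radius-vector \<open>r\<close>, an immersion of a parameter domain \<open>D\<close>
  (no global injectivity is required). Its tangent space is taken at a parameter value, as a linear
  subspace of the ambient space.
\<close>

definition immersion_on :: "'a::euclidean_space set \<Rightarrow> ('a \<Rightarrow> 'b::euclidean_space) \<Rightarrow> bool" where
  "immersion_on D r \<longleftrightarrow> smooth_on D r \<and> (\<forall>u\<in>D. inj (frechet_derivative r (at u)))"

definition spherical_submanifold :: "'a::euclidean_space set \<Rightarrow> ('a \<Rightarrow> 'b::euclidean_space) \<Rightarrow> bool" where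
  "spherical_submanifold D r \<longleftrightarrow> immersion_on D r \<and> r ` D \<subseteq> sphere 0 1"

definition tangent_space :: "('a::euclidean_space \<Rightarrow> 'b::euclidean_space) \<Rightarrow> 'a \<Rightarrow> 'b set" where
  "tangent_space r u = range (frechet_derivative r (at u))"

definition parallel_unit_normal ::
    "'a::euclidean_space set \<Rightarrow> ('a \<Rightarrow> 'b::euclidean_space) \<Rightarrow> ('a \<Rightarrow> 'b) \<Rightarrow> bool" where
  "parallel_unit_normal D r \<nu> \<longleftrightarrow>
     smooth_on D \<nu> \<and>
     (\<forall>u\<in>D. norm (\<nu> u) = 1 \<and>
            \<nu> u \<bullet> r u = 0 \<and>
            (\<forall>t\<in>tangent_space r u. \<nu> u \<bullet> t = 0) \<and>
            (\<forall>h. frechet_derivative \<nu> (at u) h \<in> tangent_space r u))"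

text \<open>
  For an \<open>n\<close>-dimensional submanifold of the unit sphere of \<open>(m+n)\<close>-space, the number of normals in a
  frame, \<open>DIM('b) - DIM('a) - 1\<close>, is \<open>m - 1\<close>.
\<close>

definition flat_normal_bundle :: "'a::euclidean_space set \<Rightarrow> ('a \<Rightarrow> 'b::euclidean_space) \<Rightarrow> bool" where
  "flat_normal_bundle D r \<longleftrightarrow>
     (\<forall>u\<in>D. \<exists>N. open N \<and> u \<in> N \<and> N \<subseteq> D \<and>
        (\<exists>\<nu> :: nat \<Rightarrow> 'a \<Rightarrow> 'b.
           (\<forall>a < DIM('b) - DIM('a) - 1. parallel_unit_normal N r (\<nu> a)) \<and>
           (\<forall>a < DIM('b) - DIM('a) - 1. \<forall>b < DIM('b) - DIM('a) - 1.
              a \<noteq> b \<longrightarrow> (\<forall>v\<in>N. \<nu> a v \<bullet> \<nu> b v = 0))))"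

text \<open>The form \<open>(df, dg)\<close> has the coefficients \<open>pdiff i f \<bullet> pdiff j g\<close>.\<close>

definition diagonal_form ::
    "(real^'n::finite) set \<Rightarrow> (real^'n \<Rightarrow> 'b::euclidean_space) \<Rightarrow> (real^'n \<Rightarrow> 'b) \<Rightarrow> bool" where
  "diagonal_form D f g \<longleftrightarrow>
     (\<forall>u\<in>D. \<forall>i j. i \<noteq> j \<longrightarrow> pdiff i f u \<bullet> pdiff j g u = 0)"

text \<open>
  Parallel normals exist only locally in general, so the forms \<open>(dr, d\<nu>)\<close> are considered for all
  parallel normals \<open>\<nu>\<close> over all open parts of the parameter domain. The property thus does not
  depend on a choice of a parallel frame.
\<close>

definition curvature_line_coordinates ::
    "(real^'n::finite) set \<Rightarrow> (real^'n \<Rightarrow> 'b::euclidean_space) \<Rightarrow> bool" where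
  "curvature_line_coordinates D r \<longleftrightarrow>
     diagonal_form D r r \<and>
     (\<forall>N \<nu>. open N \<and> N \<subseteq> D \<and> parallel_unit_normal N r \<nu> \<longrightarrow> diagonal_form N r \<nu>)"

end

theory Submission
  imports Defs
begin

text \<open>
  Put \<open>A = V\<^sup>-\<^sup>1\<close> and let \<open>Q\<close> be the block matrix with the rows of \<open>1 - U A U\<^sup>t\<close> above those of
  \<open>- A U\<^sup>t\<close>. The constraint on \<open>V + V\<^sup>t\<close> gives \<open>A\<^sup>t U\<^sup>t U A + A\<^sup>t A = A + A\<^sup>t\<close>, hence
  \<open>W\<^sup>t W = 1\<close>, \<open>Q\<^sup>t Q = 1\<close> and \<open>Q\<^sup>t W = 0\<close>, while \<open>dA = - A U\<^sup>t dU A\<close> gives \<open>dW = Q dU A\<close>.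
  So \<open>P\<^sub>k = Q X\<^sub>k\<close> together with the columns of \<open>W\<close> is an orthonormal frame in which
  \<open>\<partial>\<^sub>k w\<^sup>\<alpha>\<close> is a multiple of \<open>P\<^sub>k\<close> for every \<open>\<alpha>\<close>. If \<open>w\<^sup>\<gamma>\<close> is an immersion, the \<open>P\<^sub>k\<close> span its tangent
  space, so the other columns are parallel normals, and any parallel normal is a combination of
  them with locally constant coefficients.
\<close>

section \<open>Calculus of \<open>C\<^sup>k\<close> maps and matrix functions\<close>

text \<open>On an open set \<open>frechet_derivative\<close> at a point sees only nearby values, so
  agreement on \<open>S\<close> passes to the derivatives and the induction runs with
  \<open>f\<close> and \<open>g\<close> arbitrary.\<close>

lemma Ck_on_cong:
  fixes f g :: "'a::real_normed_vector \<Rightarrow> 'b::real_normed_vector"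
  assumes "open S" and "\<And>x. x \<in> S \<Longrightarrow> f x = g x" and "Ck_on k S f"
  shows "Ck_on k S g"
  using assms(2,3)
proof (induction k arbitrary: f g)
  case 0
  then show ?case
    by (simp cong: continuous_on_cong)
next
  case (Suc k)
  have d: "(g has_derivative frechet_derivative f (at x)) (at x)" if "x \<in> S" for x
  proof (rule has_derivative_transform_within_open[OF _ assms(1) that Suc.prems(1)])
    show "(f has_derivative frechet_derivative f (at x)) (at x)"
      using Suc.prems(2) that by (simp flip: frechet_derivative_works)
  qed
  have "frechet_derivative f (at x) v = frechet_derivative g (at x) v" if "x \<in> S" for x v
    using frechet_derivative_at[OF d[OF that]] by simp
  moreover have "Ck_on k S (\<lambda>x. frechet_derivative f (at x) v)" for v
    using Suc.prems(2) by simp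
  ultimately have "Ck_on k S (\<lambda>x. frechet_derivative g (at x) v)" for v
    by (rule Suc.IH)
  moreover have "g differentiable (at x)" if "x \<in> S" for x
    using d[OF that] by (rule differentiableI)
  ultimately show ?case
    by simp
qed

text \<open>Lets an explicit derivative \<open>f'\<close> replace the abstract
  \<open>frechet_derivative\<close> in the recursion; every regularity argument below enters through
  this rule.\<close>

lemma Ck_on_SucI:
  assumes "open S"
    and "\<And>x. x \<in> S \<Longrightarrow> (f has_derivative f' x) (at x)"
    and "\<And>v. Ck_on k S (\<lambda>x. f' x v)"
  shows "Ck_on (Suc k) S f"
proof -
  have "f' x v = frechet_derivative f (at x) v" if "x \<in> S" for x v
    using frechet_derivative_at[OF assms(2)[OF that]] by simp
  then have "Ck_on k S (\<lambda>x. frechet_derivative f (at x) v)" for v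
    by (rule Ck_on_cong[OF assms(1) _ assms(3)[of v]])
  with assms(2) show ?thesis
    by (auto simp: differentiable_def)
qed

lemma Ck_on_SucD: "Ck_on (Suc k) S f \<Longrightarrow> Ck_on k S f"
proof (induction k arbitrary: f)
  case 0
  then show ?case
    by (auto intro!: continuous_at_imp_continuous_on differentiable_imp_continuous_within)
next
  case (Suc k)
  then show ?case by auto
qed

lemma Ck_on_const: "Ck_on k S (\<lambda>x. c)"
  by (induction k arbitrary: c) auto

lemma Ck_on_add:
  assumes "open S" and "Ck_on k S f" and "Ck_on k S g"
  shows "Ck_on k S (\<lambda>x. f x + g x)"
  using assms(2,3)
proof (induction k arbitrary: f g)
  case 0
  then show ?case by (auto intro: continuous_intros)
next
  case (Suc k)
  show ?case
  proof (rule Ck_on_SucI[OF assms(1)])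
    fix x assume "x \<in> S"
    with Suc.prems show "((\<lambda>x. f x + g x) has_derivative
        (\<lambda>v. frechet_derivative f (at x) v + frechet_derivative g (at x) v)) (at x)"
      by (auto intro!: derivative_eq_intros simp flip: frechet_derivative_works)
  qed (use Suc in auto)
qed

lemma Ck_on_sum:
  assumes "open S" and "\<And>i. i \<in> I \<Longrightarrow> Ck_on k S (f i)"
  shows "Ck_on k S (\<lambda>x. \<Sum>i\<in>I. f i x)"
  using assms(2)
  by (induction I rule: infinite_finite_induct)
    (auto intro: Ck_on_const Ck_on_add[OF assms(1)])

lemma Ck_on_linear:
  assumes "open S" and "bounded_linear h" and "Ck_on k S f"
  shows "Ck_on k S (\<lambda>x. h (f x))"
  using assms(3)
proof (induction k arbitrary: f)
  case 0
  then show ?case using assms(2) by (auto intro: bounded_linear.continuous_on)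
next
  case (Suc k)
  show ?case
  proof (rule Ck_on_SucI[OF assms(1)])
    fix x assume "x \<in> S"
    with Suc.prems show "((\<lambda>x. h (f x)) has_derivative
        (\<lambda>v. h (frechet_derivative f (at x) v))) (at x)"
      by (auto intro!: bounded_linear.has_derivative[OF assms(2)] simp flip: frechet_derivative_works)
  qed (use Suc in auto)
qed

text \<open>The product rule gives a sum of two terms of the same bilinear shape, so the induction
  hypothesis for arbitrary \<open>f\<close> and \<open>g\<close> applies to each; the factor left
  undifferentiated gives up one order by \<open>Ck_on_SucD\<close>.\<close>

lemma Ck_on_bilinear:
  assumes "open S" and "bounded_bilinear h" and "Ck_on k S f" and "Ck_on k S g"
  shows "Ck_on k S (\<lambda>x. h (f x) (g x))"
  using assms(3,4)
proof (induction k arbitrary: f g)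
  case 0
  then show ?case using assms(2) by (auto intro: bounded_bilinear.continuous_on)
next
  case (Suc k)
  show ?case
  proof (rule Ck_on_SucI[OF assms(1)])
    fix x assume "x \<in> S"
    with Suc.prems show "((\<lambda>x. h (f x) (g x)) has_derivative
        (\<lambda>v. h (f x) (frechet_derivative g (at x) v) + h (frechet_derivative f (at x) v) (g x))) (at x)"
      by (auto intro!: bounded_bilinear.FDERIV[OF assms(2)] simp flip: frechet_derivative_works)
  next
    fix v
    show "Ck_on k S (\<lambda>x. h (f x) (frechet_derivative g (at x) v) + h (frechet_derivative f (at x) v) (g x))"
      using Suc by (intro Ck_on_add assms(1) Suc.IH) (auto dest: Ck_on_SucD simp del: Ck_on.simps, auto)
  qed
qed

section \<open>Differentiability and smoothness of matrix products and inverses\<close>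

lemma bounded_bilinear_matrix_matrix_mult:
  "bounded_bilinear ((**) :: real^'m^'n \<Rightarrow> real^'p^'m \<Rightarrow> real^'p^'n)"
  unfolding bilinear_conv_bounded_bilinear[symmetric] bilinear_def
  by (auto intro!: linearI simp: matrix_add_ldistrib matrix_scalar_ac
      simp flip: scalar_matrix_assoc)
    (simp_all add: matrix_matrix_mult_def vec_eq_iff sum.distrib distrib_right)

lemma bounded_linear_transpose: "bounded_linear (transpose :: real^'m^'n \<Rightarrow> real^'n^'m)"
  by (auto intro!: linearI simp: transpose_def vec_eq_iff simp flip: linear_conv_bounded_linear)

lemma differentiable_matrixI:
  fixes f :: "'a::real_normed_vector \<Rightarrow> real^'m^'n"
  assumes "\<And>i j. (\<lambda>x. f x $ i $ j) differentiable (at a within S)"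
  shows "f differentiable (at a within S)"
  using assms
  by (subst differentiable_componentwise_within)
    (auto simp: Basis_vec_def inner_axis)

lemma has_derivative_matrixI:
  fixes f :: "'a::real_normed_vector \<Rightarrow> real^'m^'n"
  assumes "\<And>i j. ((\<lambda>x. f x $ i $ j) has_derivative (\<lambda>h. f' h $ i $ j)) (at a within S)"
  shows "(f has_derivative f') (at a within S)"
  using assms
  by (subst has_derivative_componentwise_within)
    (auto simp: Basis_vec_def inner_axis)

lemma differentiable_det:
  fixes f :: "'a::real_normed_vector \<Rightarrow> real^'n^'n"
  assumes "\<And>i j. (\<lambda>x. f x $ i $ j) differentiable (at a within S)"
  shows "(\<lambda>x. det (f x)) differentiable (at a within S)"
proof -
  have "(\<lambda>x. \<Prod>i\<in>UNIV. f x $ i $ p i) differentiable (at a within S)" for p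
    unfolding differentiable_def
    by (rule exI, rule has_derivative_prod, rule assms[THEN frechet_derivative_works[THEN iffD1]])
  then show ?thesis
    by (auto simp: det_def intro!: differentiable_sum differentiable_mult)
qed

lemma matrix_inv_mult:
  assumes "invertible M"
  shows "M ** matrix_inv M = mat 1" and "matrix_inv M ** M = mat 1"
  using someI_ex[OF assms[unfolded invertible_def]] unfolding matrix_inv_def by auto

text \<open>Cramer's rule for \<open>M x = axis j 1\<close>, whose solution is column
  \<open>j\<close> of the inverse. It turns differentiability of the inverse into that of
  determinants.\<close>

lemma matrix_inv_component:
  fixes M :: "real^'n^'n"
  assumes "invertible M"
  shows "matrix_inv M $ k $ j = det (\<chi> i l. if l = k then axis j 1 $ i else M $ i $ l) / det M"
proof -
  have "M *v column j (matrix_inv M) = axis j 1"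
    by (metis assms matrix_inv_mult(1) matrix_vector_mul_assoc matrix_vector_mul_lid matrix_vector_mult_basis)
  then have "column j (matrix_inv M) =
      (\<chi> k. det (\<chi> i l. if l = k then axis j 1 $ i else M $ i $ l) / det M)"
    using cramer[of M] assms by (simp add: invertible_det_nz)
  then show ?thesis
    by (simp add: column_def vec_eq_iff)
qed

text \<open>Cramer's rule shows only that some derivative exists; its value then follows by
  differentiating \<open>V x ** matrix_inv (V x) = mat 1\<close>.\<close>

lemma has_derivative_matrix_inv:
  fixes V :: "'a::real_normed_vector \<Rightarrow> real^'n^'n"
  assumes "open S" and "a \<in> S" and inv: "\<And>x. x \<in> S \<Longrightarrow> invertible (V x)"
    and V: "(V has_derivative V') (at a)"
  shows "((\<lambda>x. matrix_inv (V x)) has_derivative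
          (\<lambda>h. - (matrix_inv (V a) ** V' h ** matrix_inv (V a)))) (at a)"
proof -
  let ?A = "\<lambda>x. matrix_inv (V x)"
  have Vd: "(\<lambda>x. V x $ i $ j) differentiable (at a)" for i j
    unfolding differentiable_def
    by (rule exI, rule bounded_linear.has_derivative[OF bounded_linear_vec_nth],
        rule bounded_linear.has_derivative[OF bounded_linear_vec_nth], rule V)
  have "?A differentiable (at a)"
  proof (rule differentiable_matrixI)
    fix k j
    have "(\<lambda>x. det (\<chi> i l. if l = k then axis j 1 $ i else V x $ i $ l) / det (V x)) differentiable (at a)"
    proof (intro differentiable_divide differentiable_det Vd)
      show "(\<lambda>x. (\<chi> i l. if l = k then axis j 1 $ i else V x $ i $ l) $ i $ l) differentiable at a" for i l
        using Vd by (cases "l = k") auto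
    qed (use assms in \<open>simp add: invertible_det_nz\<close>)
    then obtain D where D: "((\<lambda>x. det (\<chi> i l. if l = k then axis j 1 $ i else V x $ i $ l) / det (V x))
        has_derivative D) (at a)"
      unfolding differentiable_def by blast
    have "((\<lambda>x. ?A x $ k $ j) has_derivative D) (at a)"
      by (rule has_derivative_transform_within_open[OF D assms(1,2)])
        (simp add: matrix_inv_component inv)
    then show "(\<lambda>x. ?A x $ k $ j) differentiable (at a)"
      unfolding differentiable_def by blast
  qed
  then obtain A' where A': "(?A has_derivative A') (at a)"
    unfolding differentiable_def by blast
  interpret mm: bounded_bilinear "(**) :: real^'n^'n \<Rightarrow> real^'n^'n \<Rightarrow> real^'n^'n"
    by (rule bounded_bilinear_matrix_matrix_mult)
  have "((\<lambda>x. V x ** ?A x) has_derivative (\<lambda>h. V a ** A' h + V' h ** ?A a)) (at a)"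
    by (rule mm.FDERIV[OF V A'])
  moreover have "((\<lambda>x. V x ** ?A x) has_derivative (\<lambda>h. 0)) (at a)"
    by (rule has_derivative_transform_within_open[OF has_derivative_const assms(1,2)])
      (simp add: matrix_inv_mult inv)
  ultimately have "V a ** A' h + V' h ** ?A a = 0" for h
    by (rule has_derivative_unique[THEN fun_cong])
  \<comment> \<open>Multiplying by the inverse from the left isolates \<open>A' h\<close>.\<close>
  then have "?A a ** (V a ** A' h + V' h ** ?A a) = 0" for h
    by simp
  then have "A' h = - (?A a ** V' h ** ?A a)" for h
    using inv[OF assms(2)]
    by (simp add: mm.add_right matrix_mul_assoc matrix_inv_mult eq_neg_iff_add_eq_0)
  then have "A' = (\<lambda>h. - (?A a ** V' h ** ?A a))" by (rule ext)
  with A' show ?thesis by simp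
qed

text \<open>Bootstrapping: the derivative of the inverse is a product of the inverse, twice, and the
  derivative of \<open>V\<close>, so order \<open>k\<close> for the inverse yields order
  \<open>k + 1\<close>.\<close>

lemma smooth_on_matrix_inv:
  fixes V :: "'a::real_normed_vector \<Rightarrow> real^'n^'n"
  assumes "open S" and inv: "\<And>x. x \<in> S \<Longrightarrow> invertible (V x)" and V: "smooth_on S V"
  shows "smooth_on S (\<lambda>x. matrix_inv (V x))"
proof -
  have V': "(V has_derivative frechet_derivative V (at x)) (at x)" if "x \<in> S" for x
    using V[unfolded smooth_on_def, rule_format, of 1] that by (simp flip: frechet_derivative_works)
  note A' = has_derivative_matrix_inv[OF assms(1) _ inv V']
  have "Ck_on k S (\<lambda>x. matrix_inv (V x))" for k
  proof (induction k)
    case 0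
    show ?case
      using A' by (auto intro!: continuous_at_imp_continuous_on has_derivative_continuous)
  next
    case (Suc k)
    have "Ck_on k S (\<lambda>x. frechet_derivative V (at x) v)" for v
      using V[unfolded smooth_on_def, rule_format, of "Suc k"] by simp
    then show ?case
      by (intro Ck_on_SucI[OF assms(1) A']
          Ck_on_linear[OF assms(1) bounded_linear_minus[OF bounded_linear_ident]]
          Ck_on_bilinear[OF assms(1) bounded_bilinear_matrix_matrix_mult] Suc.IH)
  qed
  then show ?thesis
    by (simp add: smooth_on_def)
qed

text \<open>A matrix is the sum of its entries times constant matrix units, so closure under sums
  and linear maps suffices.\<close>

lemma Ck_on_matrixI:
  fixes f :: "'a::real_normed_vector \<Rightarrow> real^'m^'n"
  assumes "open S" and "\<And>i j. Ck_on k S (\<lambda>x. f x $ i $ j)"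
  shows "Ck_on k S f"
proof -
  have if_sum: "(\<Sum>j\<in>(UNIV::'m set). if b then g j else 0) = (if b then sum g UNIV else (0::real))" for b g
    by (cases b) auto
  have "f x = (\<Sum>i\<in>UNIV. \<Sum>j\<in>UNIV. f x $ i $ j *\<^sub>R axis i (axis j 1))" for x
    by (simp add: vec_eq_iff axis_def if_distrib[of "\<lambda>v. v $ _"] if_distrib[of "\<lambda>v. _ * v"] if_sum cong: if_cong)
  then have "f = (\<lambda>x. \<Sum>i\<in>UNIV. \<Sum>j\<in>UNIV. f x $ i $ j *\<^sub>R axis i (axis j 1))" by (rule ext)
  moreover have "Ck_on k S (\<lambda>x. \<Sum>i\<in>UNIV. \<Sum>j\<in>UNIV. f x $ i $ j *\<^sub>R (axis i (axis j 1) :: real^'m^'n))"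
    by (intro Ck_on_sum assms Ck_on_linear[OF assms(1) bounded_linear_scaleR_left])
  ultimately show ?thesis by simp
qed

section \<open>Block matrices and columns\<close>

lemma stack_rows_transpose_mult:
  fixes A :: "real^'m^'n" and B :: "real^'m^'k" and C :: "real^'p^'n" and D :: "real^'p^'k"
  shows "transpose (stack_rows A B) ** stack_rows C D = transpose A ** C + transpose B ** D"
  by (simp add: vec_eq_iff matrix_matrix_mult_def transpose_def stack_rows_def
      sum.Plus flip: UNIV_Plus_UNIV)

lemma stack_rows_mult: "stack_rows A B ** C = stack_rows (A ** C) (B ** C)"
  by (auto simp: vec_eq_iff matrix_matrix_mult_def stack_rows_def split: sum.split)

text \<open>Writes stacking as a sum of two linear maps, one per block, so that derivatives and
  regularity can be taken block by block.\<close>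

lemma stack_rows_eq_add:
  fixes A :: "real^'m^'n" and B :: "real^'m^'k"
  shows "stack_rows A B = stack_rows A 0 + stack_rows 0 B"
  by (auto simp: vec_eq_iff stack_rows_def split: sum.split)

lemma bounded_linear_stack_rows:
  "bounded_linear (\<lambda>A :: real^'m^'n. stack_rows A (0 :: real^'m^'k))"
  "bounded_linear (\<lambda>B :: real^'m^'k. stack_rows (0 :: real^'m^'n) B)"
  by (auto intro!: linearI simp: vec_eq_iff stack_rows_def
      simp flip: linear_conv_bounded_linear split: sum.split)

lemma has_derivative_stack_rows:
  fixes f :: "'a::real_normed_vector \<Rightarrow> real^'m^'n" and g :: "'a \<Rightarrow> real^'m^'k"
  assumes "(f has_derivative f') F" and "(g has_derivative g') F"
  shows "((\<lambda>x. stack_rows (f x) (g x)) has_derivative (\<lambda>h. stack_rows (f' h) (g' h))) F"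
  by (subst stack_rows_eq_add, subst (2) stack_rows_eq_add)
    (intro has_derivative_add assms
      bounded_linear.has_derivative[OF bounded_linear_stack_rows(1)]
      bounded_linear.has_derivative[OF bounded_linear_stack_rows(2)])

lemma Ck_on_stack_rows:
  fixes f :: "'a::real_normed_vector \<Rightarrow> real^'m^'n" and g :: "'a \<Rightarrow> real^'m^'k"
  assumes "open S" and "Ck_on k S f" and "Ck_on k S g"
  shows "Ck_on k S (\<lambda>x. stack_rows (f x) (g x))"
  by (subst stack_rows_eq_add)
    (intro Ck_on_add Ck_on_linear[OF assms(1) bounded_linear_stack_rows(1)]
      Ck_on_linear[OF assms(1) bounded_linear_stack_rows(2)] assms)

lemma bounded_linear_column: "bounded_linear (column j :: real^'m^'n \<Rightarrow> real^'n)"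
  by (auto intro!: linearI simp: column_def vec_eq_iff simp flip: linear_conv_bounded_linear)

lemma column_mult: "column j (A ** B) = A *v column j B"
  by (simp add: vec_eq_iff column_def matrix_matrix_mult_def matrix_vector_mult_def)

lemma inner_matrix_vector_mult:
  fixes A :: "real^'m^'k" and B :: "real^'n^'k"
  shows "(A *v x) \<bullet> (B *v y) = x \<bullet> ((transpose A ** B) *v y)"
  by (metis dot_lmul_matrix matrix_vector_mul_assoc transpose_matrix_vector inner_commute transpose_transpose)

section \<open>Orthonormal frames adapted to a submanifold\<close>

text \<open>Orthonormality makes the family injective and independent; having as many members as the
  dimension, it spans.\<close>

lemma orthonormal_family_expand:
  fixes e :: "'i::finite \<Rightarrow> 'b::euclidean_space"
  assumes card: "CARD('i) = DIM('b)"
    and e: "\<And>i j. e i \<bullet> e j = (if i = j then 1 else 0)"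
  shows "(\<Sum>i\<in>UNIV. (v \<bullet> e i) *\<^sub>R e i) = v"
proof -
  have inj: "inj e"
  proof (rule injI)
    fix i j assume "e i = e j"
    then show "i = j" using e[of i i] e[of i j] by (auto split: if_splits)
  qed
  have orth: "pairwise orthogonal (range e)"
    using e by (auto simp: pairwise_def orthogonal_def)
  have norm1: "norm x = 1" if "x \<in> range e" for x
    using that e by (auto simp: norm_eq_sqrt_inner)
  then have "0 \<notin> range e" by (metis norm_zero zero_neq_one)
  with orth have "independent (range e)"
    by (rule pairwise_orthogonal_independent)
  moreover have "card (range e) = DIM('b)"
    using inj card by (simp add: card_image)
  ultimately have "span (range e) = UNIV"
    by (metis dim_eq_card dim_eq_full)
  then have "(\<Sum>x\<in>range e. (v \<bullet> x) *\<^sub>R x) = v"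
    by (intro orthonormal_basis_expand orth norm1) auto
  then show ?thesis
    using inj by (simp add: sum.reindex)
qed

text \<open>The geometric core, free of \<open>U\<close> and \<open>V\<close>: \<open>P\<close> and
  \<open>w\<close> together are an orthonormal frame, and every \<open>w \<alpha>\<close> moves in
  the direction of \<open>P k\<close> along the \<open>k\<close>-th coordinate, at rate
  \<open>c \<alpha> k\<close>.\<close>

lemma orthonormal_frame_submanifold:
  fixes D :: "(real^'n::finite) set"
    and P :: "'n \<Rightarrow> real^'n \<Rightarrow> 'b::euclidean_space"
    and w :: "'m::finite \<Rightarrow> real^'n \<Rightarrow> 'b"
    and c :: "'m \<Rightarrow> 'n \<Rightarrow> real^'n \<Rightarrow> real"
  assumes "open D"
    and dim: "DIM('b) = CARD('n) + CARD('m)"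
    and PP: "\<And>i j u. u \<in> D \<Longrightarrow> P i u \<bullet> P j u = (if i = j then 1 else 0)"
    and ww: "\<And>\<alpha> \<beta> u. u \<in> D \<Longrightarrow> w \<alpha> u \<bullet> w \<beta> u = (if \<alpha> = \<beta> then 1 else 0)"
    and Pw: "\<And>i \<alpha> u. u \<in> D \<Longrightarrow> P i u \<bullet> w \<alpha> u = 0"
    and smooth: "\<And>\<alpha>. smooth_on D (w \<alpha>)"
    and der: "\<And>\<alpha> u. u \<in> D \<Longrightarrow>
           (w \<alpha> has_derivative (\<lambda>h. \<Sum>k\<in>UNIV. (h $ k * c \<alpha> k u) *\<^sub>R P k u)) (at u)"
    and imm: "immersion_on D (w \<gamma>)"
  shows "spherical_submanifold D (w \<gamma>)"
    and "flat_normal_bundle D (w \<gamma>)"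
    and "\<And>\<alpha>. \<alpha> \<noteq> \<gamma> \<Longrightarrow> parallel_unit_normal D (w \<gamma>) (w \<alpha>)"
    and "curvature_line_coordinates D (w \<gamma>)"
proof -
  have fd: "frechet_derivative (w \<alpha>) (at u) = (\<lambda>h. \<Sum>k\<in>UNIV. (h $ k * c \<alpha> k u) *\<^sub>R P k u)"
    if "u \<in> D" for \<alpha> u
    by (rule frechet_derivative_at[OF der[OF that], symmetric])
  have sum_axis: "(\<Sum>k\<in>UNIV. (axis i (1::real) $ k * a k) *\<^sub>R p k) = a i *\<^sub>R p i" for i a and p :: "'n \<Rightarrow> 'b"
  proof -
    have "(\<Sum>k\<in>UNIV. (axis i (1::real) $ k * a k) *\<^sub>R p k) = (\<Sum>k\<in>UNIV. if k = i then a k *\<^sub>R p k else 0)"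
      by (intro sum.cong) (auto simp: axis_def)
    then show ?thesis by simp
  qed
  have pd: "pdiff i (w \<alpha>) u = c \<alpha> i u *\<^sub>R P i u" if "u \<in> D" for \<alpha> i u
    by (simp add: pdiff_def fd[OF that] sum_axis)
  \<comment> \<open>A vanishing rate would put \<open>axis i 1\<close> into the kernel of an
    injective derivative.\<close>
  have c0: "c \<gamma> i u \<noteq> 0" if "u \<in> D" for i u
  proof
    assume "c \<gamma> i u = 0"
    then have "frechet_derivative (w \<gamma>) (at u) (axis i 1) = frechet_derivative (w \<gamma>) (at u) 0"
      using pd[OF that, of i \<gamma>] by (simp add: pdiff_def fd[OF that])
    with imm that have "axis i (1::real) = 0"
      unfolding immersion_on_def inj_def by blast
    then show False by (simp add: axis_eq_0_iff)
  qed
  have tangent: "tangent_space (w \<gamma>) u = {\<Sum>k\<in>UNIV. a k *\<^sub>R P k u | a. True}" (is "_ = ?T")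
    if "u \<in> D" for u
  proof
    show "tangent_space (w \<gamma>) u \<subseteq> ?T"
      by (auto simp: tangent_space_def fd[OF that])
    show "?T \<subseteq> tangent_space (w \<gamma>) u"
    proof clarify
      fix a :: "'n \<Rightarrow> real"
      \<comment> \<open>The preimage rescales each coefficient by its nonzero rate.\<close>
      have "(\<Sum>k\<in>UNIV. a k *\<^sub>R P k u) = frechet_derivative (w \<gamma>) (at u) (\<chi> k. a k / c \<gamma> k u)"
        using c0[OF that] by (simp add: fd[OF that])
      then show "(\<Sum>k\<in>UNIV. a k *\<^sub>R P k u) \<in> tangent_space (w \<gamma>) u"
        by (simp add: tangent_space_def)
    qed
  qed
  have P_tangent: "P i u \<in> tangent_space (w \<gamma>) u" if "u \<in> D" for i u
  proof -
    have "P i u = (\<Sum>k\<in>UNIV. (if k = i then 1 else 0) *\<^sub>R P k u)"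
      by (simp add: if_distrib[of "\<lambda>x. x *\<^sub>R _"] cong: if_cong)
    then show ?thesis
      unfolding tangent[OF that] by (intro CollectI exI[of _ "\<lambda>k. if k = i then 1 else 0"]) simp
  qed
  show "spherical_submanifold D (w \<gamma>)"
    using imm ww by (auto simp: spherical_submanifold_def norm_eq_sqrt_inner)
  show normal: "parallel_unit_normal D (w \<gamma>) (w \<alpha>)" if "\<alpha> \<noteq> \<gamma>" for \<alpha>
    unfolding parallel_unit_normal_def
  proof (intro conjI ballI allI smooth)
    fix u assume u: "u \<in> D"
    show "norm (w \<alpha> u) = 1" "w \<alpha> u \<bullet> w \<gamma> u = 0"
      using ww[OF u] that by (auto simp: norm_eq_sqrt_inner)
    show "w \<alpha> u \<bullet> t = 0" if "t \<in> tangent_space (w \<gamma>) u" for t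
      using that Pw[OF u] unfolding tangent[OF u]
      by (auto simp: inner_sum_left inner_commute[of "w _ _"])
    show "frechet_derivative (w \<alpha>) (at u) h \<in> tangent_space (w \<gamma>) u" for h
      unfolding tangent[OF u] fd[OF u] by auto
  qed
  show "flat_normal_bundle D (w \<gamma>)"
  proof -
    let ?m = "DIM('b) - DIM(real^'n) - 1"
    \<comment> \<open>The definition numbers the normals by naturals below \<open>?m\<close>, which
      is \<open>CARD('m) - 1\<close>; a bijection renumbers the columns other than
      \<open>\<gamma>\<close>.\<close>
    have "card (UNIV - {\<gamma>}) = ?m"
      using dim by (simp add: card_Diff_singleton)
    then obtain f where f: "bij_betw f {..<?m} (UNIV - {\<gamma>})"
      using finite_same_card_bij[of "{..<?m}" "UNIV - {\<gamma>}"] by auto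
    have 1: "f a \<noteq> \<gamma>" if "a < ?m" for a
      using bij_betwE[OF f] that by auto
    have 2: "f a \<noteq> f b" if "a < ?m" "b < ?m" "a \<noteq> b" for a b
      using bij_betw_imp_inj_on[OF f] that by (auto simp: inj_on_def)
    show ?thesis
      unfolding flat_normal_bundle_def
    proof (intro ballI exI[of _ D] conjI exI[of _ "\<lambda>a. w (f a)"] allI impI)
      show "w (f a) v \<bullet> w (f b) v = 0" if "a < ?m" "b < ?m" "a \<noteq> b" "v \<in> D" for a b v
        using ww[OF that(4)] 2[OF that(1-3)] by simp
    qed (use assms(1) normal 1 in auto)
  qed
  have diag: "diagonal_form N (w \<gamma>) \<nu>"
    if N: "open N" "N \<subseteq> D" and \<nu>: "parallel_unit_normal N (w \<gamma>) \<nu>" for N \<nu>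
    unfolding diagonal_form_def
  proof (intro ballI allI impI)
    fix u and i j :: 'n
    assume u: "u \<in> N" and ij: "i \<noteq> j"
    have \<nu>P: "\<nu> v \<bullet> P k v = 0" if "v \<in> N" for v k
      using \<nu> that N P_tangent by (auto simp: parallel_unit_normal_def)
    \<comment> \<open>A parallel normal is a combination of the fields \<open>w \<alpha>\<close> with locally constant coefficients.\<close>
    have expand: "(\<Sum>\<alpha>\<in>UNIV. (\<nu> v \<bullet> w \<alpha> v) *\<^sub>R w \<alpha> v) = \<nu> v" if v: "v \<in> N" for v
    proof -
      have vD: "v \<in> D" using v N by auto
      \<comment> \<open>The full frame, indexed by the disjoint sum. Its \<open>P\<close> part
        contributes nothing to the expansion, since \<open>\<nu>\<close> is normal.\<close>
      let ?e = "case_sum (\<lambda>k. P k v) (\<lambda>\<alpha>. w \<alpha> v)"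
      have "(\<Sum>i\<in>UNIV. (\<nu> v \<bullet> ?e i) *\<^sub>R ?e i) = \<nu> v"
        using PP[OF vD] ww[OF vD] Pw[OF vD] dim
        by (intro orthonormal_family_expand)
          (auto simp: inner_commute[of "w _ _" "P _ _"] split: sum.split)
      then show ?thesis
        using \<nu>P[OF v] by (simp add: sum.Plus flip: UNIV_Plus_UNIV)
    qed
    have uD: "u \<in> D" using u N by auto
    define \<nu>' where "\<nu>' = frechet_derivative \<nu> (at u)"
    have d\<nu>: "(\<nu> has_derivative \<nu>') (at u)"
    proof -
      have "Ck_on 1 N \<nu>" using \<nu> by (simp add: parallel_unit_normal_def smooth_on_def)
      then show ?thesis using u by (simp add: \<nu>'_def flip: frechet_derivative_works)
    qed
    have \<nu>'w: "\<nu>' h \<bullet> w \<alpha> u = 0" for h \<alpha>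
    proof -
      have "\<nu>' h \<in> tangent_space (w \<gamma>) u"
        using \<nu> u by (simp add: parallel_unit_normal_def \<nu>'_def)
      then show ?thesis
        using Pw[OF uD] unfolding tangent[OF uD] by (auto simp: inner_sum_left)
    qed
    \<comment> \<open>Both terms of the product rule vanish: the derivative of \<open>\<nu>\<close>
      is tangent, hence orthogonal to \<open>w \<alpha>\<close>, and that of
      \<open>w \<alpha>\<close> is a combination of the \<open>P k\<close>, hence orthogonal to
      \<open>\<nu>\<close>.\<close>
    have coeff: "((\<lambda>v. \<nu> v \<bullet> w \<alpha> v) has_derivative (\<lambda>h. 0)) (at u)" for \<alpha>
      using has_derivative_inner[OF d\<nu> der[OF uD, of \<alpha>]]
      by (simp add: \<nu>'w inner_sum_right \<nu>P[OF u])
    have "((\<lambda>v. \<Sum>\<alpha>\<in>UNIV. (\<nu> v \<bullet> w \<alpha> v) *\<^sub>R w \<alpha> v) has_derivative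
        (\<lambda>h. \<Sum>\<alpha>\<in>UNIV. (\<nu> u \<bullet> w \<alpha> u) *\<^sub>R (\<Sum>k\<in>UNIV. (h $ k * c \<alpha> k u) *\<^sub>R P k u) + 0 *\<^sub>R w \<alpha> u)) (at u)"
      by (intro has_derivative_sum has_derivative_scaleR coeff der uD)
    then have "(\<nu> has_derivative
        (\<lambda>h. \<Sum>\<alpha>\<in>UNIV. (\<nu> u \<bullet> w \<alpha> u) *\<^sub>R (\<Sum>k\<in>UNIV. (h $ k * c \<alpha> k u) *\<^sub>R P k u) + 0 *\<^sub>R w \<alpha> u)) (at u)"
      by (rule has_derivative_transform_within_open[OF _ N(1) u expand])
    \<comment> \<open>With the coefficients stationary at \<open>u\<close>,
      \<open>pdiff j \<nu> u\<close> is a multiple of \<open>P j u\<close>, whereas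
      \<open>pdiff i (w \<gamma>) u\<close> is one of \<open>P i u\<close>.\<close>
    from frechet_derivative_at[OF this, symmetric]
    have "pdiff j \<nu> u = (\<Sum>\<alpha>\<in>UNIV. (\<nu> u \<bullet> w \<alpha> u) *\<^sub>R c \<alpha> j u *\<^sub>R P j u)"
      by (simp add: pdiff_def sum_axis del: scaleR_scaleR)
    then show "pdiff i (w \<gamma>) u \<bullet> pdiff j \<nu> u = 0"
      using ij by (simp add: pd[OF uD] inner_sum_right PP[OF uD])
  qed
  show "curvature_line_coordinates D (w \<gamma>)"
    unfolding curvature_line_coordinates_def
    using diag pd PP by (auto simp: diagonal_form_def)
qed

section \<open>The stacked frame\<close>

lemmas matrix_mult_distribs =
  bounded_bilinear.add_left[OF bounded_bilinear_matrix_matrix_mult]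
  bounded_bilinear.add_right[OF bounded_bilinear_matrix_matrix_mult]
  bounded_bilinear.diff_left[OF bounded_bilinear_matrix_matrix_mult]
  bounded_bilinear.diff_right[OF bounded_bilinear_matrix_matrix_mult]
  bounded_bilinear.minus_left[OF bounded_bilinear_matrix_matrix_mult]
  bounded_bilinear.minus_right[OF bounded_bilinear_matrix_matrix_mult]

lemmas transpose_distribs =
  linear_add[OF bounded_linear.linear[OF bounded_linear_transpose]]
  linear_diff[OF bounded_linear.linear[OF bounded_linear_transpose]]
  linear_neg[OF bounded_linear.linear[OF bounded_linear_transpose]]

lemma stacked_frame_orthonormal:
  fixes U :: "real^'m^'n" and V :: "real^'m^'m"
  assumes V: "V + transpose V = transpose U ** U + mat 1" and inv: "invertible V"
  defines "A \<equiv> matrix_inv V"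
  defines "W \<equiv> stack_rows (U ** A) (A - mat 1)"
    and "Q \<equiv> stack_rows (mat 1 - U ** A ** transpose U) (- (A ** transpose U))"
  shows "transpose W ** W = mat 1" and "transpose Q ** Q = mat 1" and "transpose Q ** W = 0"
proof -
  have AV: "V ** A = mat 1" "A ** V = mat 1"
    using matrix_inv_mult[OF inv] by (auto simp: A_def)
  \<comment> \<open>Conjugating the constraint by \<open>A\<close> turns
    \<open>V + transpose V\<close> into \<open>A + transpose A\<close>.\<close>
  have "transpose A ** (V + transpose V) ** A = transpose A ** (V ** A) + transpose (V ** A) ** A"
    by (simp add: matrix_mult_distribs matrix_mul_assoc matrix_transpose_mul)
  then have key: "transpose A ** transpose U ** U ** A = A + transpose A - transpose A ** A"
    by (simp add: V AV matrix_mult_distribs matrix_mul_assoc transpose_mat algebra_simps)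
  \<comment> \<open>After left association, the left side of \<open>key\<close> is no longer a
    subterm once \<open>U\<close> stands in front; \<open>key'\<close> is the version that rewrites
    those products.\<close>
  then have "U ** (transpose A ** transpose U ** U ** A) = U ** (A + transpose A - transpose A ** A)"
    by simp
  then have key': "U ** transpose A ** transpose U ** U ** A = U ** A + U ** transpose A - U ** transpose A ** A"
    by (simp add: matrix_mult_distribs matrix_mul_assoc)
  show "transpose W ** W = mat 1" "transpose Q ** Q = mat 1" "transpose Q ** W = 0"
    unfolding W_def Q_def stack_rows_transpose_mult
    by (simp_all add: matrix_mult_distribs transpose_distribs matrix_mul_assoc matrix_transpose_mul
        transpose_mat key key')
qed

section \<open>Differentials, smoothness and adapted frame for the given \<open>U\<close>,
  \<open>V\<close> and \<open>W\<close>\<close>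

theorem mainTheorem6:
  fixes D :: "(real^'n::finite) set"
    and \<beta> :: "'n \<Rightarrow> 'n \<Rightarrow> real^'n \<Rightarrow> real"
    and X :: "'n \<Rightarrow> real^'n \<Rightarrow> real^'n"
    and H :: "'m::finite \<Rightarrow> 'n \<Rightarrow> real^'n \<Rightarrow> real"
    and s :: "'m \<Rightarrow> 'n \<Rightarrow> real^'n \<Rightarrow> real"
    and U :: "real^'n \<Rightarrow> real^'m^'n"
    and V :: "real^'n \<Rightarrow> real^'m^'m"
    and W :: "real^'n \<Rightarrow> real^'m^('n + 'm)"
  assumes "CARD('n) \<ge> 2"
    and "open D" and "simply_connected D"
    and "\<And>i j. i \<noteq> j \<Longrightarrow> smooth_on D (\<beta> i j)"
    and "\<And>i j k u. u \<in> D \<Longrightarrow> i \<noteq> j \<Longrightarrow> i \<noteq> k \<Longrightarrow> j \<noteq> k \<Longrightarrow>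
           pdiff k (\<beta> i j) u = \<beta> i k u * \<beta> k j u"
    and "\<And>i j u. u \<in> D \<Longrightarrow> i \<noteq> j \<Longrightarrow>
           pdiff i (\<beta> i j) u + pdiff j (\<beta> j i) u + (\<Sum>k\<in>UNIV - {i, j}. \<beta> k i u * \<beta> k j u) = 0"
    and "\<And>i. smooth_on D (X i)"
    and "\<And>i u. u \<in> D \<Longrightarrow> norm (X i u) = 1"
    and "\<And>i j u. u \<in> D \<Longrightarrow> i \<noteq> j \<Longrightarrow> X i u \<bullet> X j u = 0"
    and "\<And>i j u. u \<in> D \<Longrightarrow> j \<noteq> i \<Longrightarrow> pdiff j (X i) u = \<beta> i j u *\<^sub>R X j u"
    and "\<And>i u. u \<in> D \<Longrightarrow> pdiff i (X i) u = - (\<Sum>k\<in>UNIV - {i}. \<beta> k i u *\<^sub>R X k u)"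
    and "\<And>\<alpha> i. smooth_on D (H \<alpha> i)"
    and "\<And>\<alpha> i j u. u \<in> D \<Longrightarrow> i \<noteq> j \<Longrightarrow> pdiff i (H \<alpha> j) u = \<beta> i j u * H \<alpha> i u"
    and "\<And>\<alpha> i u. u \<in> D \<Longrightarrow>
           (s \<alpha> i has_derivative (\<lambda>du. \<Sum>k\<in>UNIV. X k u $ i * H \<alpha> k u * du $ k)) (at u)"
    and "U = (\<lambda>u. \<chi> i \<alpha>. s \<alpha> i u)"
    and "\<And>u. u \<in> D \<Longrightarrow>
           (V has_derivative (\<lambda>du. transpose (U u) ** frechet_derivative U (at u) du)) (at u)"
    and "\<And>u. u \<in> D \<Longrightarrow> V u + transpose (V u) = transpose (U u) ** U u + mat 1"
    and "\<And>u. u \<in> D \<Longrightarrow> invertible (V u)"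
    and "W = (\<lambda>u. stack_rows (U u ** matrix_inv (V u)) (matrix_inv (V u) - mat 1))"
  shows "(\<forall>u\<in>D. transpose (W u) ** W u = mat 1) \<and>
         (\<forall>\<gamma>. immersion_on D (\<lambda>u. column \<gamma> (W u)) \<longrightarrow>
            spherical_submanifold D (\<lambda>u. column \<gamma> (W u)) \<and>
            flat_normal_bundle D (\<lambda>u. column \<gamma> (W u)) \<and>
            (\<forall>\<alpha>. \<alpha> \<noteq> \<gamma> \<longrightarrow>
               parallel_unit_normal D (\<lambda>u. column \<gamma> (W u)) (\<lambda>u. column \<alpha> (W u))) \<and>
            curvature_line_coordinates D (\<lambda>u. column \<gamma> (W u)))"
proof -
  note D = \<open>open D\<close>
  note X_smooth = assms(7) and X_norm = assms(8) and X_orth = assms(9) and H_smooth = assms(12)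
    and ds = assms(14) and U_eq = assms(15) and dV = assms(16) and VV = assms(17)
    and V_inv = assms(18) and W_eq = assms(19)
  \<comment> \<open>The differential of \<open>U\<close>: a sum over \<open>k\<close> of rank-one
    matrices, the column \<open>X k\<close> times the row of the \<open>H \<alpha> k\<close>,
    weighted by \<open>h $ k\<close>.\<close>
  define U' where "U' u h = (\<chi> i \<alpha>. \<Sum>k\<in>UNIV. X k u $ i * H \<alpha> k u * h $ k)" for u h :: "real^'n"
  define A where "A u = matrix_inv (V u)" for u
  define Q where "Q u = stack_rows (mat 1 - U u ** A u ** transpose (U u)) (- (A u ** transpose (U u)))" for u
  define P where "P k u = Q u *v X k u" for k u
  \<comment> \<open>Multiplying the rows of the \<open>H \<beta> k\<close> by \<open>A\<close> gives
    the rates of the columns of \<open>W\<close>; up to sign they are the Lame coefficients of these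
    columns.\<close>
  define c where "c \<alpha> k u = (\<Sum>\<beta>\<in>UNIV. H \<beta> k u * A u $ \<beta> $ \<alpha>)" for \<alpha> k u

  have W_A: "W u = stack_rows (U u ** A u) (A u - mat 1)" for u
    by (simp add: W_eq A_def)
  have WW: "transpose (W u) ** W u = mat 1" and QQ: "transpose (Q u) ** Q u = mat 1"
    and QW: "transpose (Q u) ** W u = 0" if "u \<in> D" for u
    using stacked_frame_orthonormal[OF VV[OF that] V_inv[OF that]] by (simp_all add: W_A Q_def A_def)

  have dU: "(U has_derivative U' u) (at u)" if "u \<in> D" for u
    by (rule has_derivative_matrixI) (use ds[OF that] in \<open>simp add: U_eq U'_def\<close>)
  have fdU: "frechet_derivative U (at u) = U' u" if "u \<in> D" for u
    by (rule frechet_derivative_at[OF dU[OF that], symmetric])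
  have dV': "(V has_derivative (\<lambda>h. transpose (U u) ** U' u h)) (at u)" if "u \<in> D" for u
    using dV[OF that] by (simp add: fdU[OF that])
  have dA: "(A has_derivative (\<lambda>h. - (A u ** (transpose (U u) ** U' u h) ** A u))) (at u)" if "u \<in> D" for u
    using has_derivative_matrix_inv[OF D that V_inv dV'[OF that]]
    unfolding A_def[symmetric] by simp
  have dW: "(W has_derivative (\<lambda>h. Q u ** U' u h ** A u)) (at u)" if "u \<in> D" for u
  proof -
    \<comment> \<open>The raw product rule. In the upper block \<open>U' u h ** A u\<close> factors
      out on the right and leaves \<open>mat 1 - U A U^t\<close>; in the lower block it leaves
      \<open>- A U^t\<close>. These are the blocks of \<open>Q\<close>.\<close>
    have "(W has_derivative (\<lambda>h. stack_rows
        (U u ** - (A u ** (transpose (U u) ** U' u h) ** A u) + U' u h ** A u)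
        (- (A u ** (transpose (U u) ** U' u h) ** A u) - 0))) (at u)"
      unfolding W_A
      by (intro has_derivative_stack_rows has_derivative_diff has_derivative_const
          bounded_bilinear.FDERIV[OF bounded_bilinear_matrix_matrix_mult] dU dA that)
    then show ?thesis
      by (simp add: Q_def stack_rows_mult matrix_mult_distribs matrix_mul_assoc)
  qed

  have s_Ck: "Ck_on k D (s \<alpha> i)" and U'_Ck: "Ck_on k D (\<lambda>u. U' u v)" for k \<alpha> i v
  proof -
    \<comment> \<open>Smoothness of \<open>s\<close> is read off its differential, which is built
      from smooth \<open>X\<close> and \<open>H\<close>: order \<open>k + 1\<close> holds for every
      \<open>k\<close>, and \<open>Ck_on_SucD\<close> drops the surplus. The same works for
      \<open>V\<close> below.\<close>
    have entry: "Ck_on k D (\<lambda>u. \<Sum>l\<in>UNIV. X l u $ i * H \<alpha> l u * h $ l)" for i \<alpha> h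
      using X_smooth H_smooth unfolding smooth_on_def
      by (intro Ck_on_sum[OF D] Ck_on_bilinear[OF D bounded_bilinear_mult] Ck_on_const
          Ck_on_linear[OF D bounded_linear_vec_nth]) auto
    show "Ck_on k D (s \<alpha> i)"
      by (rule Ck_on_SucD, rule Ck_on_SucI[OF D ds entry])
    show "Ck_on k D (\<lambda>u. U' u v)"
      by (rule Ck_on_matrixI[OF D]) (simp add: U'_def entry)
  qed
  have U_Ck: "Ck_on k D U" for k
    by (rule Ck_on_matrixI[OF D]) (simp add: U_eq s_Ck)
  have "Ck_on k D V" for k
    by (rule Ck_on_SucD, rule Ck_on_SucI[OF D dV'], assumption)
      (intro Ck_on_bilinear[OF D bounded_bilinear_matrix_matrix_mult] U'_Ck U_Ck
        Ck_on_linear[OF D bounded_linear_transpose])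
  then have "smooth_on D V"
    by (simp add: smooth_on_def)
  then have "smooth_on D A"
    unfolding A_def by (intro smooth_on_matrix_inv D V_inv)
  then have A_Ck: "Ck_on k D A" for k
    by (simp add: smooth_on_def)
  have W_Ck: "Ck_on k D W" for k
  proof -
    have "Ck_on k D (\<lambda>u. stack_rows (U u ** A u) (A u + - mat 1))"
      by (intro Ck_on_stack_rows Ck_on_add Ck_on_const A_Ck U_Ck D
          Ck_on_bilinear[OF D bounded_bilinear_matrix_matrix_mult])
    then show ?thesis by (simp flip: W_A)
  qed
  have w_smooth: "smooth_on D (\<lambda>u. column \<alpha> (W u))" for \<alpha>
    by (simp add: smooth_on_def Ck_on_linear[OF D bounded_linear_column W_Ck])

  have dw: "((\<lambda>u. column \<alpha> (W u)) has_derivative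
      (\<lambda>h. \<Sum>k\<in>UNIV. (h $ k * c \<alpha> k u) *\<^sub>R P k u)) (at u)" if "u \<in> D" for \<alpha> u
  proof -
    \<comment> \<open>Applying the rank-one summands of \<open>U'\<close> to a column of
      \<open>A\<close> leaves multiples of the \<open>X k\<close>, which \<open>Q\<close> then
      carries to the \<open>P k\<close>.\<close>
    have U'_col: "U' u h *v column \<alpha> (A u) = (\<Sum>k\<in>UNIV. (h $ k * c \<alpha> k u) *\<^sub>R X k u)" for h
    proof (rule vec_eq_iff[THEN iffD2], rule allI)
      fix i
      have "(U' u h *v column \<alpha> (A u)) $ i =
          (\<Sum>\<beta>\<in>UNIV. \<Sum>k\<in>UNIV. X k u $ i * H \<beta> k u * h $ k * A u $ \<beta> $ \<alpha>)"
        by (simp add: U'_def matrix_vector_mult_def column_def sum_distrib_right)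
      also have "\<dots> = (\<Sum>k\<in>UNIV. \<Sum>\<beta>\<in>UNIV. X k u $ i * H \<beta> k u * h $ k * A u $ \<beta> $ \<alpha>)"
        by (rule sum.swap)
      also have "\<dots> = (\<Sum>k\<in>UNIV. (h $ k * c \<alpha> k u) *\<^sub>R X k u) $ i"
        by (simp add: c_def sum_distrib_left sum_distrib_right mult_ac)
      finally show "(U' u h *v column \<alpha> (A u)) $ i = (\<Sum>k\<in>UNIV. (h $ k * c \<alpha> k u) *\<^sub>R X k u) $ i" .
    qed
    have "column \<alpha> (Q u ** U' u h ** A u) = (\<Sum>k\<in>UNIV. (h $ k * c \<alpha> k u) *\<^sub>R P k u)" for h
    proof -
      have "column \<alpha> (Q u ** U' u h ** A u) = Q u *v (U' u h *v column \<alpha> (A u))"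
        by (simp add: column_mult matrix_vector_mul_assoc)
      then show ?thesis
        by (simp add: U'_col P_def linear_sum[OF matrix_vector_mul_linear] matrix_vector_mult_scaleR)
    qed
    with bounded_linear.has_derivative[OF bounded_linear_column dW[OF that], of \<alpha>]
    show ?thesis by simp
  qed

  have PP: "P i u \<bullet> P j u = (if i = j then 1 else 0)" if "u \<in> D" for i j u
    using X_norm[OF that, of i] X_orth[OF that, of i j]
    by (auto simp: P_def inner_matrix_vector_mult QQ[OF that] norm_eq_1)
  have ww: "column \<alpha> (W u) \<bullet> column \<beta> (W u) = (if \<alpha> = \<beta> then 1 else 0)" if "u \<in> D" for \<alpha> \<beta> u
    using WW[OF that] by (simp add: matrix_mult_transpose_dot_column vec_eq_iff mat_def)
  \<comment> \<open>Reading the column as \<open>W u *v axis \<alpha> 1\<close> reduces the claim to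
    \<open>QW\<close>.\<close>
  have Pw: "P i u \<bullet> column \<alpha> (W u) = 0" if "u \<in> D" for i \<alpha> u
    by (simp add: P_def inner_matrix_vector_mult QW[OF that] flip: matrix_vector_mult_basis)

  show ?thesis
    using WW orthonormal_frame_submanifold[where w = "\<lambda>\<alpha> u. column \<alpha> (W u)" and P = P and c = c,
        OF D _ PP ww Pw w_smooth dw]
    by simp
qed

end
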